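(* For each $i\in\{3,4,5\}$, the graph $G_i$ with vertex set $\mathcal{T}_i$ defined in the context is an infinite tree. Every vertex of $G_i$ other than its fundamental solution has degree $4$, where the fundamental solutions of $G_3,G_4,G_5$ are $(3,6)$, $(4,4)$, $(5,5)$ respectively. The fundamental solutions of $G_3$ and $G_5$ have degree $2$, and the fundamental solution of $G_4$ has degree $1$.
   Context: For $i\in\{3,4,5\}$ let $\mathcal{T}_i$ be the set of ordered pairs $(a,b)$ of positive integers with $a\le b$, $\gcd(a,b)=i$, and $a^2b^2-4(a+b)^2$ the square of an integer (possibly $0$). (These are the ordered pairs of side lengths of parallelograms with vertices in $\mathbb{Z}^2$ whose perimeter equals their area and whose side lengths have gcd $i$.) The fundamental solution of $\mathcal{T}_i$ is the element $(a,b)$ for which $a+b$ is minimal. For $(a,b)\in\mathcal{T}_i$ put $s=\sqrt{a^2b^2-4(a+b)^2}$ and define $$\varphi_1(a,b)=\left(a,\tfrac{a^2b+as}{2}-2a-b\right),\qquad \varphi_2(a,b)=\left(a,\tfrac{a^2b-as}{2}-2a-b\right),$$ $$\psi_1(a,b)=\left(\tfrac{ab^2+bs}{2}-2b-a,\,b\right),\qquad \psi_2(a,b)=\left(\tfrac{ab^2-bs}{2}-2b-a,\,b\right),$$ where after applying any of these maps the two entries of the image $(a',b')$ are interchanged if necessary so that $a'\le b'$. $G_i$ is the simple undirected graph with vertex set $\mathcal{T}_i$ in which two distinct vertices are joined by an edge if one of them is the image of the other under one of the four maps $\varphi_1,\varphi_2,\psi_1,\psi_2$. *)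

theory Defs
  imports Complex_Main "Graph_Theory.Graph_Theory"
begin

definition discr :: "int \<times> int \<Rightarrow> int" where
  "discr = (\<lambda>(a, b). a\<^sup>2 * b\<^sup>2 - 4 * (a + b)\<^sup>2)"

definition solutions :: "int \<Rightarrow> (int \<times> int) set" where
  "solutions i = {(a, b). 0 < a \<and> 0 < b \<and> a \<le> b \<and> gcd a b = i \<and> (\<exists>k. discr (a, b) = k\<^sup>2)}"

definition is_fundamental :: "int \<Rightarrow> int \<times> int \<Rightarrow> bool" where
  "is_fundamental i p \<longleftrightarrow> is_arg_min (\<lambda>(a, b). a + b) (\<lambda>q. q \<in> solutions i) p"

text \<open>
  The four maps are taken over the reals, so that neither the division by 2 nor the square root
  is truncated; an edge then requires the real image to be the coercion of an integral solution.
\<close>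

definition real_pair :: "int \<times> int \<Rightarrow> real \<times> real" where
  "real_pair = (\<lambda>(a, b). (real_of_int a, real_of_int b))"

definition sort_pair :: "real \<times> real \<Rightarrow> real \<times> real" where
  "sort_pair = (\<lambda>(x, y). if x \<le> y then (x, y) else (y, x))"

definition root_discr :: "int \<times> int \<Rightarrow> real" where
  "root_discr p = sqrt (real_of_int (discr p))"

definition phi1 :: "int \<times> int \<Rightarrow> real \<times> real" where
  "phi1 = (\<lambda>(a, b). let s = root_discr (a, b) in
     sort_pair (of_int a, (of_int a ^ 2 * of_int b + of_int a * s) / 2 - 2 * of_int a - of_int b))"

definition phi2 :: "int \<times> int \<Rightarrow> real \<times> real" where
  "phi2 = (\<lambda>(a, b). let s = root_discr (a, b) in
     sort_pair (of_int a, (of_int a ^ 2 * of_int b - of_int a * s) / 2 - 2 * of_int a - of_int b))"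

definition psi1 :: "int \<times> int \<Rightarrow> real \<times> real" where
  "psi1 = (\<lambda>(a, b). let s = root_discr (a, b) in
     sort_pair ((of_int a * of_int b ^ 2 + of_int b * s) / 2 - 2 * of_int b - of_int a, of_int b))"

definition psi2 :: "int \<times> int \<Rightarrow> real \<times> real" where
  "psi2 = (\<lambda>(a, b). let s = root_discr (a, b) in
     sort_pair ((of_int a * of_int b ^ 2 - of_int b * s) / 2 - 2 * of_int b - of_int a, of_int b))"

definition is_image :: "int \<times> int \<Rightarrow> int \<times> int \<Rightarrow> bool" where
  "is_image p q \<longleftrightarrow> real_pair q \<in> {phi1 p, phi2 p, psi1 p, psi2 p}"

text \<open>
  A simple undirected graph is represented as a loop-free symmetric digraph, each edge
  contributing one arc in either direction.
\<close>

definition solution_graph :: "int \<Rightarrow> (int \<times> int) pair_pre_digraph" where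
  "solution_graph i =
     \<lparr> pverts = solutions i,
       parcs = {(p, q). p \<in> solutions i \<and> q \<in> solutions i \<and> p \<noteq> q \<and> (is_image p q \<or> is_image q p)} \<rparr>"

lemma pair_bidirected_digraph_solution_graph: "pair_bidirected_digraph (solution_graph i)"
  by unfold_locales (auto simp: solution_graph_def symmetric_def arcs_ends_def arc_to_ends_def sym_def)

text \<open>
  The library's \<^const>\<open>forest\<close> (hence \<^const>\<open>tree\<close>) forbids directed cycles, and in a symmetric
  digraph traversing an edge back and forth is one. In a loop-free digraph without parallel arcs,
  the cycles of length at least 3 are exactly the cycles of the undirected graph.
\<close>

definition undirected_tree :: "'a pair_pre_digraph \<Rightarrow> bool" where
  "undirected_tree G \<longleftrightarrow>
     Digraph_Component.connected (with_proj G) \<and>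
     \<not> (\<exists>p. pre_digraph.cycle (with_proj G) p \<and> length p \<ge> 3)"

definition vertex_degree :: "'a pair_pre_digraph \<Rightarrow> 'a \<Rightarrow> nat" where
  "vertex_degree G v = out_degree (with_proj G) v"

end

theory Submission
  imports Defs
begin

text \<open>
  The images of \<open>(a, b)\<close> under \<open>\<phi>\<^sub>1, \<phi>\<^sub>2\<close> replace \<open>b\<close> by the two roots of an integral quadratic that is
  symmetric in \<open>b\<close> and the root (Vieta jumping), and the \<open>\<psi>\<close> maps do the same with \<open>a\<close>; hence adjacency
  is symmetric and stays inside the solution set. Measure vertices by \<open>a + b\<close>. For \<open>a \<le> b\<close>, both \<open>\<psi>\<close> images
  are larger, and at most one \<open>\<phi>\<close> image is smaller since the product of the two roots exceeds \<open>b\<^sup>2\<close>. So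
  every vertex has at most one smaller neighbour, and a cycle is refuted at its largest vertex.
  Exactly one image is smaller iff \<open>(a\<^sup>2 - 4) * (b - a) > 8 * a\<close>, which for gcd 3, 4, 5 fails only
  at the fundamental solution; the other vertices descend to it.
\<close>

section \<open>Trees from unique descent\<close>

lemma pcas_nth:
  assumes "pcas u p v" and "Suc i < length p"
  shows "snd (p ! i) = fst (p ! Suc i)"
  using assms
proof (induction p arbitrary: u i)
  case (Cons e es)
  show ?case
  proof (cases i)
    case 0
    with Cons.prems show ?thesis by (cases es) auto
  next
    case (Suc j)
    with Cons show ?thesis by auto
  qed
qed simp

lemma pcas_hd_last:
  assumes "pcas u p v" and "p \<noteq> []"
  shows "fst (p ! 0) = u" and "snd (p ! (length p - 1)) = v"
  using assms
proof (induction p arbitrary: u)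
  case (Cons e es)
  { case 1 with Cons show ?case by simp
  next
    case 2 with Cons show ?case by (cases es) auto }
qed simp_all

text \<open>The tail drops the starting vertex, which a closed walk meets again at its end.
  Distinctness in a cycle thus becomes distinctness of the arc heads.\<close>

lemma tl_pawalk_verts:
  assumes "pcas u p v" and "p \<noteq> []"
  shows "tl (pawalk_verts u p) = map snd p"
  using assms
proof (induction p arbitrary: u)
  case (Cons e es)
  then show ?case by (cases es) auto
qed simp

text \<open>Where \<open>h\<close> is largest on the cycle, both cyclic neighbours are lower by
  \<open>neq\<close>, so \<open>uniq\<close> identifies them. With length at least 3 they sit at
  different positions, which distinctness forbids.\<close>

lemma no_cycle_if_unique_descent:
  fixes h :: "'a \<Rightarrow> nat"
  assumes sym: "\<And>u v. (u, v) \<in> parcs G \<Longrightarrow> (v, u) \<in> parcs G"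
    and neq: "\<And>u v. (u, v) \<in> parcs G \<Longrightarrow> h u \<noteq> h v"
    and uniq: "\<And>u v w. \<lbrakk>(v, u) \<in> parcs G; (v, w) \<in> parcs G; h u < h v; h w < h v\<rbrakk> \<Longrightarrow> u = w"
    and cyc: "pre_digraph.cycle (with_proj G) p" and len: "length p \<ge> 3"
  shows False
proof -
  from cyc obtain u where arcs: "set p \<subseteq> parcs G" and cas: "pcas u p u"
    and dist: "distinct (tl (pawalk_verts u p))" and ne: "p \<noteq> []"
    unfolding pre_digraph.cycle_def pre_digraph.awalk_def
    by (auto simp: cas_with_proj_eq awalk_verts_with_proj_eq)
  define n where "n = length p"
  define f where "f k = snd (p ! k)" for k
  have n3: "n \<ge> 3" using len n_def by simp
  have inj: "i = j" if "i < n" "j < n" "f i = f j" for i j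
    using dist tl_pawalk_verts[OF cas ne] that nth_eq_iff_index_eq[of "map snd p" i j]
    by (simp add: n_def f_def)
  define M where "M = Max ((\<lambda>k. h (f k)) ` {..<n})"
  have fin: "finite ((\<lambda>k. h (f k)) ` {..<n})" "(\<lambda>k. h (f k)) ` {..<n} \<noteq> {}"
    using n3 by (auto simp: lessThan_empty_iff)
  obtain k where k: "k < n" "h (f k) = M"
    using Max_in[OF fin] unfolding M_def by (metis (no_types, lifting) imageE lessThan_iff)
  have max: "h (f j) \<le> h (f k)" if "j < n" for j
    unfolding k(2) M_def using that fin by (intro Max_ge) auto
  \<comment> \<open>Cyclic predecessor and successor of \<open>k\<close>; for \<open>n = 2\<close>
    they would coincide.\<close>
  define i where "i = (if k = 0 then n - 1 else k - 1)"
  define j where "j = (if k = n - 1 then 0 else Suc k)"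
  have ij: "i < n" "j < n" "i \<noteq> j" using n3 k(1) by (auto simp: i_def j_def)
  have pred: "fst (p ! k) = f i"
    using pcas_nth[OF cas, of "k - 1"] pcas_hd_last[OF cas ne] k(1)
    by (cases k) (auto simp: i_def f_def n_def)
  have succ: "fst (p ! j) = f k"
    using pcas_nth[OF cas, of k] pcas_hd_last[OF cas ne] k(1)
    by (auto simp: j_def f_def n_def)
  have "p ! k \<in> parcs G" "p ! j \<in> parcs G"
    using arcs k(1) ij(2) nth_mem unfolding n_def by blast+
  then have e: "(f k, f i) \<in> parcs G" "(f k, f j) \<in> parcs G"
    using sym pred succ unfolding f_def by (metis prod.collapse)+
  then have "f i = f j"
    using uniq[OF e] neq[OF e(1)] neq[OF e(2)] max[OF ij(1)] max[OF ij(2)] by linarith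
  with inj ij show False by blast
qed

lemma undirected_tree_if_unique_descent:
  fixes h :: "'a \<Rightarrow> nat"
  assumes bi: "pair_bidirected_digraph G"
    and neq: "\<And>u v. (u, v) \<in> parcs G \<Longrightarrow> h u \<noteq> h v"
    and uniq: "\<And>u v w. \<lbrakk>(v, u) \<in> parcs G; (v, w) \<in> parcs G; h u < h v; h w < h v\<rbrakk> \<Longrightarrow> u = w"
    and root: "r \<in> pverts G"
    and desc: "\<And>v. \<lbrakk>v \<in> pverts G; v \<noteq> r\<rbrakk> \<Longrightarrow> \<exists>u. (v, u) \<in> parcs G \<and> h u < h v"
  shows "undirected_tree G"
proof -
  interpret pair_bidirected_digraph G by fact
  have to_root: "v \<rightarrow>\<^sup>*\<^bsub>with_proj G\<^esub> r" if "v \<in> pverts G" for v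
    using that
  proof (induction "h v" arbitrary: v rule: less_induct)
    case less
    show ?case
    proof (cases "v = r")
      case True
      with root show ?thesis by (simp add: reachable_refl)
    next
      case False
      with desc less.prems obtain u where u: "(v, u) \<in> parcs G" "h u < h v" by blast
      then have "u \<rightarrow>\<^sup>*\<^bsub>with_proj G\<^esub> r" using less.hyps in_arcsD2 by blast
      with u(1) show ?thesis by (meson adj_reachable_trans)
    qed
  qed
  have from_root: "r \<rightarrow>\<^sup>*\<^bsub>with_proj G\<^esub> v" if "v \<in> pverts G" for v
    using symmetric_reachable[OF _ to_root[OF that]] sym_arcs by simp
  \<comment> \<open>Connectedness means reachability in the symmetric closure, which for a symmetric
    digraph is its own reachability; walks are routed through \<open>r\<close>.\<close>
  have "Digraph_Component.connected (with_proj G)"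
    using root reachable_trans[OF to_root from_root]
    by (intro connectedI) (auto simp: reachable_mk_symmetric_eq[OF sym_arcs])
  moreover have "\<not> (\<exists>p. pre_digraph.cycle (with_proj G) p \<and> length p \<ge> 3)"
    using no_cycle_if_unique_descent[of G h] arcs_symmetric neq uniq by blast
  ultimately show ?thesis by (simp add: undirected_tree_def)
qed

lemma vertex_degree_eq_card: "vertex_degree G v = card {u. (v, u) \<in> parcs G}"
proof -
  have "out_arcs (with_proj G) v = Pair v ` {u. (v, u) \<in> parcs G}"
    by (auto simp: out_arcs_def)
  then show ?thesis
    by (simp add: vertex_degree_def out_degree_def card_image inj_on_def)
qed

section \<open>The quadratic behind the four maps\<close>

text \<open>Its roots in \<open>w\<close> are the numbers by which the two maps fixing the entry \<open>c\<close> of the pair with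
  entries \<open>c, x\<close> replace \<open>x\<close>.\<close>

definition vieta_poly :: "int \<Rightarrow> int \<Rightarrow> int \<Rightarrow> int" where
  "vieta_poly c x w = x\<^sup>2 + w\<^sup>2 - (c\<^sup>2 - 2) * x * w + 4 * c * (x + w) + 4 * c\<^sup>2 + c ^ 4"

definition int_sort :: "int \<Rightarrow> int \<Rightarrow> int \<times> int" where
  "int_sort x y = (min x y, max x y)"

lemma vieta_poly_commute: "vieta_poly c x w = vieta_poly c w x"
  by (simp add: vieta_poly_def algebra_simps)

lemma int_sort_commute: "int_sort x y = int_sort y x"
  by (simp add: int_sort_def min.commute max.commute)

lemma discr_commute: "discr (x, y) = discr (y, x)"
  by (simp add: discr_def algebra_simps)

text \<open>The quadratic has discriminant \<open>c\<^sup>2 * discr (c, x)\<close>, so a square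
  \<open>discr\<close> gives rational roots, and parity makes them integral. The divisibility claims
  later preserve the gcd.\<close>

lemma vieta_roots:
  assumes "discr (c, x) = s\<^sup>2"
  obtains z z' where "2 * z = c\<^sup>2 * x + c * s - 4 * c - 2 * x"
    and "2 * z' = c\<^sup>2 * x - c * s - 4 * c - 2 * x"
    and "\<And>w. vieta_poly c x w = (w - z) * (w - z')"
    and "c dvd z + x" and "c dvd z' + x"
proof -
  have s2: "s\<^sup>2 = c\<^sup>2 * x\<^sup>2 - 4 * (c + x)\<^sup>2" using assms by (simp add: discr_def)
  \<comment> \<open>\<open>s\<close> and \<open>c * x\<close> have the same parity, so the halves in
    the maps are exact; \<open>t\<close> is half of their sum.\<close>
  have "even (s\<^sup>2) = even (c\<^sup>2 * x\<^sup>2)" unfolding s2 by simp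
  then have "even (c * x + s)" by auto
  then obtain t where t: "c * x + s = 2 * t" by blast
  define z where "z = c * t - 2 * c - x"
  define z' where "z' = c * (c * x - t) - 2 * c - x"
  have z: "2 * z = c\<^sup>2 * x + c * s - 4 * c - 2 * x"
  proof -
    have "2 * z = c * (2 * t) - 4 * c - 2 * x" by (simp add: z_def algebra_simps)
    then show ?thesis unfolding t[symmetric] by algebra
  qed
  have z': "2 * z' = c\<^sup>2 * x - c * s - 4 * c - 2 * x"
  proof -
    have "2 * z' = c * (2 * c * x - 2 * t) - 4 * c - 2 * x" by (simp add: z'_def algebra_simps)
    then show ?thesis unfolding t[symmetric] by algebra
  qed
  have "vieta_poly c x w = (w - z) * (w - z')" for w
  proof -
    have "4 * ((w - z) * (w - z')) = (2 * w - 2 * z) * (2 * w - 2 * z')" by algebra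
    also have "\<dots> = (2 * w - (c\<^sup>2 * x - 4 * c - 2 * x))\<^sup>2 - c\<^sup>2 * s\<^sup>2"
      unfolding z z' by algebra
    also have "\<dots> = 4 * vieta_poly c x w"
      unfolding s2 vieta_poly_def by algebra
    finally show ?thesis by simp
  qed
  moreover have "c dvd z + x" "c dvd z' + x"
    by (simp_all add: z_def z'_def)
  ultimately show ?thesis using that z z' by blast
qed

section \<open>From the real maps to integral roots\<close>

lemma real_pair_eq_iff: "real_pair p = real_pair q \<longleftrightarrow> p = q"
  by (cases p; cases q) (simp add: real_pair_def)

lemma sort_pair_of_int: "sort_pair (of_int x, of_int y) = real_pair (int_sort x y)"
  by (auto simp: sort_pair_def real_pair_def int_sort_def min_def max_def)

text \<open>The \<open>\<phi>\<close> maps yield the two roots attached to \<open>a\<close>, the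
  \<open>\<psi>\<close> maps those attached to \<open>b\<close>. Naming roots instead of maps
  removes signs and square roots from all later arguments.\<close>

lemma is_image_iff_vieta:
  assumes "\<exists>k. discr (a, b) = k\<^sup>2"
  shows "is_image (a, b) q \<longleftrightarrow>
    (\<exists>w. vieta_poly a b w = 0 \<and> q = int_sort a w) \<or> (\<exists>w. vieta_poly b a w = 0 \<and> q = int_sort b w)"
proof -
  from assms obtain k where "discr (a, b) = k\<^sup>2" by blast
  \<comment> \<open>The nonnegative choice makes \<open>s\<close> equal to the real square root in
    \<open>root_discr\<close>.\<close>
  then obtain s where s: "discr (a, b) = s\<^sup>2" "s \<ge> 0"
    by (metis abs_ge_zero power2_abs)
  then have s': "discr (b, a) = s\<^sup>2" by (simp add: discr_commute)
  have r: "root_discr (a, b) = of_int s" using s by (simp add: root_discr_def)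
  obtain z z' where z: "2 * z = a\<^sup>2 * b + a * s - 4 * a - 2 * b"
    "2 * z' = a\<^sup>2 * b - a * s - 4 * a - 2 * b"
    "\<And>w. vieta_poly a b w = (w - z) * (w - z')"
    using vieta_roots[OF s(1)] by metis
  obtain y y' where y: "2 * y = b\<^sup>2 * a + b * s - 4 * b - 2 * a"
    "2 * y' = b\<^sup>2 * a - b * s - 4 * b - 2 * a"
    "\<And>w. vieta_poly b a w = (w - y) * (w - y')"
    using vieta_roots[OF s'] by metis
  have real_root: "x = of_int r" if "2 * x = of_int (2 * r)" for x :: real and r
    using that by simp
  have "(of_int a ^ 2 * of_int b + of_int a * of_int s) / 2 - 2 * of_int a - of_int b = (of_int z :: real)"
    by (rule real_root) (simp only: z(1), simp)
  then have "phi1 (a, b) = sort_pair (of_int a, of_int z)"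
    by (simp only: phi1_def r prod.case Let_def)
  moreover have "(of_int a ^ 2 * of_int b - of_int a * of_int s) / 2 - 2 * of_int a - of_int b = (of_int z' :: real)"
    by (rule real_root) (simp only: z(2), simp)
  then have "phi2 (a, b) = sort_pair (of_int a, of_int z')"
    by (simp only: phi2_def r prod.case Let_def)
  moreover have "(of_int a * of_int b ^ 2 + of_int b * of_int s) / 2 - 2 * of_int b - of_int a = (of_int y :: real)"
    by (rule real_root) (simp only: y(1), simp)
  then have "psi1 (a, b) = sort_pair (of_int y, of_int b)"
    by (simp only: psi1_def r prod.case Let_def)
  moreover have "(of_int a * of_int b ^ 2 - of_int b * of_int s) / 2 - 2 * of_int b - of_int a = (of_int y' :: real)"
    by (rule real_root) (simp only: y(2), simp)
  then have "psi2 (a, b) = sort_pair (of_int y', of_int b)"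
    by (simp only: psi2_def r prod.case Let_def)
  ultimately have "is_image (a, b) q \<longleftrightarrow>
      q \<in> {int_sort a z, int_sort a z', int_sort y b, int_sort y' b}"
    by (simp add: is_image_def sort_pair_of_int real_pair_eq_iff)
  also have "\<dots> \<longleftrightarrow> (\<exists>w. vieta_poly a b w = 0 \<and> q = int_sort a w) \<or> (\<exists>w. vieta_poly b a w = 0 \<and> q = int_sort b w)"
    unfolding z(3) y(3) int_sort_commute[of y b] int_sort_commute[of y' b] by auto
  finally show ?thesis .
qed

text \<open>Without the order condition either entry can be the kept one, and facts about one entry
  carry over to the other by symmetry.\<close>

definition unsorted_solution :: "int \<Rightarrow> int \<Rightarrow> int \<Rightarrow> bool" where
  "unsorted_solution i c x \<longleftrightarrow> 0 < c \<and> 0 < x \<and> gcd c x = i \<and> (\<exists>k. discr (c, x) = k\<^sup>2)"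

lemma unsorted_solution_commute: "unsorted_solution i c x \<longleftrightarrow> unsorted_solution i x c"
  by (auto simp: unsorted_solution_def discr_commute gcd.commute)

lemma mem_solutions_iff: "(a, b) \<in> solutions i \<longleftrightarrow> a \<le> b \<and> unsorted_solution i a b"
  by (auto simp: solutions_def unsorted_solution_def)

lemma int_sort_mem_solutions_iff: "int_sort x y \<in> solutions i \<longleftrightarrow> unsorted_solution i x y"
  using unsorted_solution_commute by (auto simp: int_sort_def mem_solutions_iff min_def max_def)

text \<open>If \<open>c \<le> 2\<close>, then \<open>c * x \<le> 2 * x < 2 * (c + x)\<close>, so
  \<open>discr\<close> is negative.\<close>

lemma unsorted_solution_ge_3:
  assumes "unsorted_solution i c x"
  shows "3 \<le> c"
proof (rule ccontr)
  assume "\<not> 3 \<le> c"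
  with assms have c: "0 < c" "c \<le> 2" "0 < x" by (auto simp: unsorted_solution_def)
  obtain k where k: "c\<^sup>2 * x\<^sup>2 - 4 * (c + x)\<^sup>2 = k\<^sup>2"
    using assms by (auto simp: unsorted_solution_def discr_def)
  have "(c * x)\<^sup>2 \<le> (2 * x)\<^sup>2" using c by (intro power_mono mult_right_mono) auto
  also have "\<dots> < (2 * (c + x))\<^sup>2" using c by (intro power_strict_mono) auto
  finally have "c\<^sup>2 * x\<^sup>2 - 4 * (c + x)\<^sup>2 < 0" by (simp add: power2_eq_square algebra_simps)
  with k show False by (metis not_less zero_le_power2)
qed

lemma vieta_product:
  assumes "\<And>w. vieta_poly c x w = (w - z) * (w - z')"
  shows "z * z' = (x + 2 * c)\<^sup>2 + c ^ 4"
  using assms[of 0] by (simp add: vieta_poly_def power2_eq_square algebra_simps)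

text \<open>Vieta jumping stays among the solutions: \<open>w\<close> is congruent to
  \<open>- x\<close> modulo \<open>c\<close>, which keeps the gcd, and the product of the roots
  forces \<open>w\<close> to be positive.\<close>

lemma unsorted_solution_vieta:
  assumes sol: "unsorted_solution i c x" and root: "vieta_poly c x w = 0"
  shows "unsorted_solution i c w"
proof -
  have c3: "3 \<le> c" "3 \<le> x"
    using sol unsorted_solution_ge_3 unsorted_solution_commute by blast+
  obtain s where s: "discr (c, x) = s\<^sup>2" and g: "gcd c x = i"
    using sol by (auto simp: unsorted_solution_def)
  have "c dvd w + x"
    using vieta_roots[OF s] root by (metis eq_iff_diff_eq_0 mult_eq_0_iff)
  then obtain t where t: "w = t * c + - x" by (metis add_diff_cancel_right' dvdE mult.commute diff_conv_add_uminus)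
  have g': "gcd c w = i"
    unfolding t using g by (simp only: gcd_add_mult gcd_neg2)
  have w: "0 < w"
  proof (rule ccontr)
    assume "\<not> 0 < w"
    then have w0: "w \<le> 0" by simp
    \<comment> \<open>The second factor is the other root, by the sum of the roots. As
      \<open>c\<close> and \<open>x\<close> are at least 3, it is at least
      \<open>5 * c - 6 - w\<close>, hence nonnegative for \<open>w \<le> 0\<close>, while the
      product is positive.\<close>
    have eq: "w * ((c\<^sup>2 - 2) * x - 4 * c - w) = (x + 2 * c)\<^sup>2 + c ^ 4"
      using root unfolding vieta_poly_def by algebra
    have "3 * c \<le> c * c" using c3 by (intro mult_right_mono) auto
    then have "3 * c \<le> c\<^sup>2" by (simp add: power2_eq_square)
    moreover from this have "(c\<^sup>2 - 2) * 3 \<le> (c\<^sup>2 - 2) * x" using c3 by (intro mult_left_mono) auto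
    ultimately have "0 \<le> (c\<^sup>2 - 2) * x - 4 * c - w" using c3 w0 by simp
    then have "w * ((c\<^sup>2 - 2) * x - 4 * c - w) \<le> 0" using w0 by (simp add: mult_nonpos_nonneg)
    moreover have "0 < (x + 2 * c)\<^sup>2 + c ^ 4" using c3 by (simp add: add_pos_pos)
    ultimately show False using eq by simp
  qed
  \<comment> \<open>\<open>x\<close> is an integral root of the quadratic attached to \<open>(c, w)\<close>, whose discriminant is
    \<open>c\<^sup>2 * discr (c, w)\<close>.\<close>
  have sq: "(2 * x - (c\<^sup>2 - 2) * w + 4 * c)\<^sup>2 = c\<^sup>2 * discr (c, w)"
    using root unfolding vieta_poly_def discr_def prod.case by algebra
  then have "c\<^sup>2 dvd (2 * x - (c\<^sup>2 - 2) * w + 4 * c)\<^sup>2" by simp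
  then have "c dvd 2 * x - (c\<^sup>2 - 2) * w + 4 * c" by simp
  then obtain k where "2 * x - (c\<^sup>2 - 2) * w + 4 * c = c * k" by blast
  with sq c3 have "discr (c, w) = k\<^sup>2" by (simp add: power_mult_distrib)
  with w g' c3 show ?thesis by (auto simp: unsorted_solution_def)
qed

text \<open>A jump is undone by a jump because \<open>vieta_poly\<close> is symmetric in the
  replaced entry and its replacement. So one direction of \<open>is_image\<close> suffices, and
  membership of \<open>q\<close> is automatic.\<close>

lemma solution_edge_iff:
  assumes "(a, b) \<in> solutions i"
  shows "((a, b), q) \<in> parcs (solution_graph i) \<longleftrightarrow> q \<noteq> (a, b) \<and>
    ((\<exists>w. vieta_poly a b w = 0 \<and> q = int_sort a w) \<or> (\<exists>w. vieta_poly b a w = 0 \<and> q = int_sort b w))"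
    (is "_ \<longleftrightarrow> _ \<and> ?N a b q")
proof -
  have img: "is_image (a', b') q' \<longleftrightarrow> ?N a' b' q'" if "(a', b') \<in> solutions i" for a' b' q'
    using that by (intro is_image_iff_vieta) (auto simp: solutions_def)
  have sol: "q \<in> solutions i" if "?N a b q"
    using that assms unsorted_solution_vieta[of i a b] unsorted_solution_vieta[of i b a]
      unsorted_solution_commute[of i a b]
    by (auto simp: mem_solutions_iff int_sort_mem_solutions_iff)
  obtain c d where q: "q = (c, d)" by fastforce
  have rev: "?N a b q" if "q \<in> solutions i" "is_image q (a, b)"
  proof -
    have N: "?N c d (a, b)" using that img q by blast
    have cd: "(c, d) = int_sort c d" using that q by (auto simp: mem_solutions_iff int_sort_def)
    \<comment> \<open>\<open>x\<close> is the entry of \<open>q\<close> that is kept,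
      \<open>y\<close> the one replaced, \<open>w\<close> its replacement.\<close>
    from N obtain x y w where xy: "(x, y) = (c, d) \<or> (x, y) = (d, c)"
      "vieta_poly x y w = 0" "(a, b) = int_sort x w" by blast
    have "vieta_poly x w y = 0" "(c, d) = int_sort x y"
      using xy cd vieta_poly_commute int_sort_commute by (metis prod.inject)+
    moreover have "(a, b) = (x, w) \<or> (a, b) = (w, x)"
      using xy(3) by (auto simp: int_sort_def min_def max_def)
    ultimately show ?thesis using q by auto
  qed
  show ?thesis
    using assms sol rev img[OF assms, of q] by (auto simp: solution_graph_def)
qed

section \<open>Size of the roots\<close>

lemma vieta_other_root:
  assumes "vieta_poly c x w = 0"
  obtains w' where "\<And>v. vieta_poly c x v = (v - w) * (v - w')"
proof
  \<comment> \<open>The witness is the sum of the roots minus \<open>w\<close>.\<close>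
  show "vieta_poly c x v = (v - w) * (v - ((c\<^sup>2 - 2) * x - 4 * c - w))" for v
    using assms unfolding vieta_poly_def by algebra
qed

text \<open>Both roots are positive and their product \<open>(x + 2 * c)\<^sup>2 + c ^ 4\<close>
  exceeds the square of \<open>max c x\<close>.\<close>

lemma vieta_roots_not_both_le:
  assumes sol: "unsorted_solution i c x"
    and fac: "\<And>v. vieta_poly c x v = (v - w) * (v - w')"
    and "w \<le> m" "w' \<le> m" "m \<le> max c x"
  shows False
proof -
  have pos: "0 < c" "0 < x" using sol by (auto simp: unsorted_solution_def)
  have "unsorted_solution i c w" "unsorted_solution i c w'"
    using unsorted_solution_vieta[OF sol] fac by auto
  then have "0 < w" "0 < w'" by (auto simp: unsorted_solution_def)
  then have "w * w' \<le> max c x * max c x" using assms(3-5) by (intro mult_mono) auto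
  also have "\<dots> < (x + 2 * c) * (x + 2 * c)" using pos by (intro mult_strict_mono) auto
  also have "\<dots> \<le> (x + 2 * c)\<^sup>2 + c ^ 4" by (simp add: power2_eq_square)
  finally show False using vieta_product[OF fac] by simp
qed

text \<open>The quadratic is positive at \<open>b\<close>, so both roots lie on the same side of
  \<open>b\<close>, and by their product this is not the lower side.\<close>

lemma vieta_root_gt:
  assumes ab: "(a, b) \<in> solutions i" and root: "vieta_poly b a w = 0"
  shows "b < w"
proof (rule ccontr)
  assume "\<not> b < w"
  have sol: "unsorted_solution i b a" and le: "a \<le> b"
    using ab unsorted_solution_commute by (auto simp: mem_solutions_iff)
  then have pos: "0 < a" by (simp add: unsorted_solution_def)
  obtain w' where fac: "\<And>v. vieta_poly b a v = (v - w) * (v - w')"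
    using vieta_other_root[OF root] by blast
  have "vieta_poly b a b = b ^ 3 * (b - a) + 9 * b\<^sup>2 + 6 * a * b + a\<^sup>2"
    unfolding vieta_poly_def by algebra
  moreover have "0 \<le> b ^ 3 * (b - a)" "0 < 9 * b\<^sup>2" "0 < 6 * a * b" "0 < a\<^sup>2"
    using le pos by auto
  ultimately have "0 < (b - w) * (b - w')" unfolding fac[symmetric] by linarith
  with \<open>\<not> b < w\<close> have "w' \<le> b" by (auto simp: zero_less_mult_iff)
  with \<open>\<not> b < w\<close> show False
    using vieta_roots_not_both_le[OF sol fac, of b] by simp
qed

lemma vieta_root_lt_unique:
  assumes ab: "(a, b) \<in> solutions i"
    and "vieta_poly a b w = 0" "vieta_poly a b u = 0" "w < b" "u < b"
  shows "w = u"
proof (rule ccontr)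
  assume "w \<noteq> u"
  obtain w' where fac: "\<And>v. vieta_poly a b v = (v - w) * (v - w')"
    using vieta_other_root[OF assms(2)] by blast
  with \<open>w \<noteq> u\<close> assms(3) have "u = w'" by simp
  then show False
    using vieta_roots_not_both_le[OF _ fac, of i b] assms by (simp add: mem_solutions_iff)
qed

section \<open>Descent in the solution graph\<close>

definition height :: "int \<times> int \<Rightarrow> nat" where
  "height p = nat (fst p + snd p)"

lemma height_int_sort_less_iff:
  assumes "0 < c" "0 < x" "0 < y"
  shows "height (int_sort c x) < height (c, y) \<longleftrightarrow> x < y"
    and "height (int_sort c x) < height (y, c) \<longleftrightarrow> x < y"
    and "height (c, y) < height (int_sort c x) \<longleftrightarrow> y < x"
    and "height (y, c) < height (int_sort c x) \<longleftrightarrow> y < x"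
  using assms by (auto simp: height_def int_sort_def min_def max_def)

text \<open>A root attached to \<open>b\<close> always leads upwards. A root \<open>w\<close>
  attached to \<open>a\<close> leads up or down according to its comparison with \<open>b\<close>;
  \<open>w = b\<close> would give back \<open>(a, b)\<close>.\<close>

lemma edge_cases:
  assumes ab: "(a, b) \<in> solutions i" and e: "((a, b), q) \<in> parcs (solution_graph i)"
  obtains (lower) w where "vieta_poly a b w = 0" "q = int_sort a w" "w < b" "height q < height (a, b)"
  | (higher) "height (a, b) < height q"
proof -
  have sol: "unsorted_solution i a b" "unsorted_solution i b a" and le: "a \<le> b"
    using ab unsorted_solution_commute by (auto simp: mem_solutions_iff)
  then have pos: "0 < a" "0 < b" by (auto simp: unsorted_solution_def)
  from e solution_edge_iff[OF ab] have ne: "q \<noteq> (a, b)"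
    and "(\<exists>w. vieta_poly a b w = 0 \<and> q = int_sort a w) \<or> (\<exists>w. vieta_poly b a w = 0 \<and> q = int_sort b w)"
    by blast+
  then consider w where "vieta_poly a b w = 0" "q = int_sort a w"
    | w where "vieta_poly b a w = 0" "q = int_sort b w" by blast
  then show ?thesis
  proof cases
    case (1 w)
    have "0 < w" using unsorted_solution_vieta[OF sol(1) 1(1)] by (simp add: unsorted_solution_def)
    moreover have "w \<noteq> b" using ne 1(2) le by (auto simp: int_sort_def)
    ultimately show ?thesis
      using 1 pos lower higher by (cases "w < b") (auto simp: height_int_sort_less_iff)
  next
    case (2 w)
    have "b < w" using vieta_root_gt[OF ab 2(1)] .
    then show ?thesis
      using 2 pos le higher by (auto simp: height_int_sort_less_iff)
  qed
qed

lemma solution_graph_vertex: "(p, q) \<in> parcs (solution_graph i) \<Longrightarrow> p \<in> solutions i"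
  by (simp add: solution_graph_def)

lemma height_edge_neq:
  assumes "(p, q) \<in> parcs (solution_graph i)"
  shows "height p \<noteq> height q"
proof -
  obtain a b where p: "p = (a, b)" by fastforce
  then have "(a, b) \<in> solutions i" using solution_graph_vertex[OF assms] by simp
  then show ?thesis using assms unfolding p by (rule edge_cases) auto
qed

lemma height_descent_unique:
  assumes "(p, q) \<in> parcs (solution_graph i)" "(p, q') \<in> parcs (solution_graph i)"
    and "height q < height p" "height q' < height p"
  shows "q = q'"
proof -
  obtain a b where p: "p = (a, b)" by fastforce
  have ab: "(a, b) \<in> solutions i" using solution_graph_vertex assms(1) p by blast
  have low: "\<exists>w. vieta_poly a b w = 0 \<and> r = int_sort a w \<and> w < b"
    if "((a, b), r) \<in> parcs (solution_graph i)" "height r < height (a, b)" for r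
    using ab that(1) by (rule edge_cases) (use that(2) in auto)
  show ?thesis using low[of q] low[of q'] assms p vieta_root_lt_unique[OF ab] by blast
qed

text \<open>A \<open>\<psi>\<close> image serves: it replaces \<open>a\<close> by some
  \<open>y > b \<ge> a\<close>.\<close>

lemma higher_neighbour:
  assumes "p \<in> solutions i"
  shows "\<exists>q. (p, q) \<in> parcs (solution_graph i) \<and> height p < height q"
proof -
  obtain a b where p: "p = (a, b)" by fastforce
  then have ab: "(a, b) \<in> solutions i" and le: "a \<le> b" and pos: "0 < a" "0 < b"
    using assms by (auto simp: solutions_def)
  obtain s where "discr (b, a) = s\<^sup>2" using ab discr_commute by (auto simp: solutions_def)
  then obtain y y' where "\<And>v. vieta_poly b a v = (v - y) * (v - y')" using vieta_roots by blast
  then have y: "vieta_poly b a y = 0" by simp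
  have "b < y" using vieta_root_gt[OF ab y] .
  then have "height (a, b) < height (int_sort b y)" using pos le by (simp add: height_int_sort_less_iff)
  moreover from this have "int_sort b y \<noteq> (a, b)" by auto
  ultimately show ?thesis using y p solution_edge_iff[OF ab] by blast
qed

lemma infinite_solutions:
  assumes "p \<in> solutions i"
  shows "infinite (solutions i)"
proof
  assume fin: "finite (solutions i)"
  then have "Max (height ` solutions i) \<in> height ` solutions i" using assms by (intro Max_in) auto
  then obtain q where q: "q \<in> solutions i" "height q = Max (height ` solutions i)" by auto
  obtain r where r: "(q, r) \<in> parcs (solution_graph i)" "height q < height r"
    using higher_neighbour[OF q(1)] by blast
  then have "r \<in> solutions i" by (simp add: solution_graph_def)
  then have "height r \<le> height q" unfolding q(2) using fin by (intro Max_ge) auto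
  with r(2) show False by simp
qed

text \<open>For \<open>a \<ge> 3\<close> the condition \<open>8 * a < (a\<^sup>2 - 4) * (b - a)\<close> says that \<open>s > a\<^sup>2\<close>, that is, that
  \<open>b\<close> lies strictly between the two roots.\<close>

lemma vieta_roots_separated:
  assumes ab: "(a, b) \<in> solutions i" and big: "8 * a < (a\<^sup>2 - 4) * (b - a)"
  obtains w w' where "\<And>v. vieta_poly a b v = (v - w) * (v - w')" "w < b" "b < w'" "0 < w"
proof -
  have sol: "unsorted_solution i a b" and pos: "0 < a" "0 < b"
    using ab by (auto simp: mem_solutions_iff unsorted_solution_def)
  obtain z z' where fac: "\<And>v. vieta_poly a b v = (v - z) * (v - z')"
    using sol vieta_roots unfolding unsorted_solution_def by metis
  have zpos: "0 < z" "0 < z'"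
    using unsorted_solution_vieta[OF sol, of z] unsorted_solution_vieta[OF sol, of z'] fac
    by (auto simp: unsorted_solution_def)
  \<comment> \<open>The positive factor \<open>a + b\<close> splits off, so \<open>big\<close> says
    exactly that the quadratic is negative at \<open>b\<close>, between its roots.\<close>
  have "vieta_poly a b b = - (((a\<^sup>2 - 4) * (b - a) - 8 * a) * (a + b))"
    unfolding vieta_poly_def by algebra
  then have "(b - z) * (b - z') < 0" unfolding fac using big pos by simp
  then consider "z < b" "b < z'" | "z' < b" "b < z" by (auto simp: mult_less_0_iff)
  then show ?thesis
  proof cases
    case 1 then show ?thesis using that fac zpos by blast
  next
    case 2 then show ?thesis using that[of z' z] fac zpos by (simp add: mult.commute)
  qed
qed

lemma lower_neighbour:
  assumes ab: "(a, b) \<in> solutions i" and big: "8 * a < (a\<^sup>2 - 4) * (b - a)"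
  shows "\<exists>q. ((a, b), q) \<in> parcs (solution_graph i) \<and> height q < height (a, b)"
proof -
  obtain w w' where "\<And>v. vieta_poly a b v = (v - w) * (v - w')" and w: "w < b" "0 < w"
    using vieta_roots_separated[OF ab big] by blast
  then have root: "vieta_poly a b w = 0" by simp
  from w have "height (int_sort a w) < height (a, b)"
    using ab by (auto simp: solutions_def height_int_sort_less_iff)
  moreover from this have "int_sort a w \<noteq> (a, b)" by auto
  ultimately show ?thesis using root solution_edge_iff[OF ab] by blast
qed

text \<open>The images are told apart by their position relative to \<open>b\<close>: both entries
  below it (\<open>w\<close>), entries on either side of it (\<open>w'\<close>), or \<open>b\<close>
  as the smaller entry (\<open>y\<close>, \<open>y'\<close>).\<close>

lemma degree_eq_4:
  assumes ab: "(a, b) \<in> solutions i" and big: "8 * a < (a\<^sup>2 - 4) * (b - a)"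
  shows "vertex_degree (solution_graph i) (a, b) = 4"
proof -
  have le: "a \<le> b" and pos: "0 < a" "0 < b" using ab by (auto simp: solutions_def)
  with big have "a \<noteq> b" by auto
  with le have less: "a < b" by simp
  obtain w w' where fac: "\<And>v. vieta_poly a b v = (v - w) * (v - w')" and w: "w < b" "b < w'" "0 < w"
    using vieta_roots_separated[OF ab big] by metis
  obtain s where s: "discr (a, b) = s\<^sup>2" "discr (b, a) = s\<^sup>2"
    using ab discr_commute by (auto simp: solutions_def)
  obtain y y' where y: "2 * y = b\<^sup>2 * a + b * s - 4 * b - 2 * a"
    "2 * y' = b\<^sup>2 * a - b * s - 4 * b - 2 * a"
    "\<And>v. vieta_poly b a v = (v - y) * (v - y')"
    using vieta_roots[OF s(2)] by metis
  have gt: "b < y" "b < y'" using vieta_root_gt[OF ab] y(3) by auto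
  have "y \<noteq> y'"
  proof
    assume "y = y'"
    with y(1,2) pos have "s = 0" by simp
    \<comment> \<open>In general this value is \<open>a ^ 4 - s\<^sup>2\<close>; for
      \<open>s = 0\<close> it is positive, although \<open>b\<close> lies strictly between the
      roots.\<close>
    with s(1) have "vieta_poly a b b = a ^ 4"
      unfolding discr_def vieta_poly_def prod.case by algebra
    then have "a ^ 4 = (b - w) * (b - w')" by (simp add: fac)
    moreover have "(b - w) * (b - w') < 0" using w by (simp add: mult_pos_neg)
    moreover have "0 < a ^ 4" using pos by simp
    ultimately show False by simp
  qed
  have "{q. ((a, b), q) \<in> parcs (solution_graph i)} =
      {int_sort a w, int_sort a w', int_sort b y, int_sort b y'}"
  proof -
    have "(a, b) \<notin> {int_sort a w, int_sort a w', int_sort b y, int_sort b y'}"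
      using less w gt by (auto simp: int_sort_def min_def max_def)
    then show ?thesis using solution_edge_iff[OF ab] fac y(3) by auto
  qed
  moreover have "card {int_sort a w, int_sort a w', int_sort b y, int_sort b y'} = 4"
  proof -
    have "distinct [int_sort a w, int_sort a w', int_sort b y, int_sort b y']"
      using less w gt \<open>y \<noteq> y'\<close> by (auto simp: int_sort_def min_def max_def)
    from distinct_card[OF this] show ?thesis by simp
  qed
  ultimately show ?thesis by (simp add: vertex_degree_eq_card)
qed

text \<open>Every solution other than \<open>r\<close> has a lower neighbour, so it is not minimal,
  and descending from it must end at \<open>r\<close>.\<close>

lemma is_fundamental_iff:
  assumes root: "r \<in> solutions i"
    and desc: "\<And>a b. \<lbrakk>(a, b) \<in> solutions i; (a, b) \<noteq> r\<rbrakk> \<Longrightarrow> 8 * a < (a\<^sup>2 - 4) * (b - a)"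
  shows "is_fundamental i v \<longleftrightarrow> v = r"
proof -
  have lower: "\<exists>q \<in> solutions i. height q < height p" if "p \<in> solutions i" "p \<noteq> r" for p
    using that lower_neighbour desc by (cases p) (fastforce simp: solution_graph_def)
  have min: "height r \<le> height q" if "q \<in> solutions i" for q
    using that
  proof (induction "height q" arbitrary: q rule: less_induct)
    case less
    show ?case
    proof (cases "q = r")
      case False
      with lower[OF less.prems] obtain p where "p \<in> solutions i" "height p < height q" by blast
      with less.hyps[of p] show ?thesis by simp
    qed simp
  qed
  have height: "height p < height q \<longleftrightarrow> (case p of (a, b) \<Rightarrow> a + b) < (case q of (a, b) \<Rightarrow> a + b)"
    if "p \<in> solutions i" "q \<in> solutions i" for p q
    using that by (auto simp: height_def solutions_def)
  have "is_fundamental i v \<longleftrightarrow> v \<in> solutions i \<and> (\<forall>q \<in> solutions i. \<not> height q < height v)"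
    using height unfolding is_fundamental_def is_arg_min_def by blast
  also have "\<dots> \<longleftrightarrow> v = r"
    using root lower min by (meson leD)
  finally show ?thesis .
qed

section \<open>The graphs for gcd 3, 4 and 5\<close>

text \<open>Reduces the general claims for a given \<open>i\<close> to one inequality away from a
  single solution \<open>r\<close>.\<close>

lemma solution_graph_structure:
  assumes root: "r \<in> solutions i"
    and desc: "\<And>a b. \<lbrakk>(a, b) \<in> solutions i; (a, b) \<noteq> r\<rbrakk> \<Longrightarrow> 8 * a < (a\<^sup>2 - 4) * (b - a)"
  shows "undirected_tree (solution_graph i) \<and> infinite (pverts (solution_graph i)) \<and>
    (\<forall>v \<in> pverts (solution_graph i). \<not> is_fundamental i v \<longrightarrow> vertex_degree (solution_graph i) v = 4)"
proof (intro conjI ballI impI)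
  have pv: "pverts (solution_graph i) = solutions i" by (simp add: solution_graph_def)
  show "undirected_tree (solution_graph i)"
  proof (rule undirected_tree_if_unique_descent[where h = height and r = r])
    show "\<exists>u. (v, u) \<in> parcs (solution_graph i) \<and> height u < height v"
      if "v \<in> pverts (solution_graph i)" "v \<noteq> r" for v
      using that lower_neighbour desc pv by (cases v) auto
  qed (use root pv pair_bidirected_digraph_solution_graph height_edge_neq height_descent_unique in auto)
  show "infinite (pverts (solution_graph i))" using infinite_solutions[OF root] pv by simp
  show "vertex_degree (solution_graph i) v = 4"
    if "v \<in> pverts (solution_graph i)" "\<not> is_fundamental i v" for v
    using that is_fundamental_iff[OF root desc] degree_eq_4 desc pv by (cases v) auto
qed

text \<open>If \<open>a < b\<close>, then \<open>a\<close> and \<open>b - a\<close> are positive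
  multiples of \<open>i\<close>, hence at least 3. The inequality then holds for
  \<open>a \<ge> 4\<close>, which leaves \<open>a = i = 3\<close>.\<close>

lemma not_separated_cases:
  assumes ab: "(a, b) \<in> solutions i" and i: "3 \<le> i" and "\<not> 8 * a < (a\<^sup>2 - 4) * (b - a)"
  shows "(a, b) = (i, i) \<or> i = 3 \<and> (a, b) = (3, 6)"
proof (cases "a = b")
  case True
  then show ?thesis using ab by (auto simp: solutions_def)
next
  case False
  have gcd: "gcd a b = i" and "a < b" "0 < a" using False ab by (auto simp: solutions_def)
  then have "i dvd a" "i dvd b - a" by auto
  then obtain d where d: "b - a = i * d" by blast
  have "i \<le> a" using \<open>i dvd a\<close> \<open>0 < a\<close> by (simp add: zdvd_imp_le)
  have "0 < i * d" using d \<open>a < b\<close> by simp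
  then have "0 < d" using i by (simp add: zero_less_mult_iff)
  then have "i * 1 \<le> i * d" using i by (intro mult_left_mono) auto
  then have "i \<le> b - a" using d by simp
  have "3 * 3 \<le> a * a" using \<open>i \<le> a\<close> i by (intro mult_mono) auto
  then have a2: "0 \<le> a\<^sup>2 - 4" by (simp add: power2_eq_square)
  have "a < 4"
  proof (rule ccontr)
    assume "\<not> a < 4"
    then have "4 * a \<le> a\<^sup>2" unfolding power2_eq_square by (intro mult_right_mono) auto
    \<comment> \<open>\<open>3 * (a\<^sup>2 - 4) \<ge> 12 * a - 12\<close>, which exceeds
      \<open>8 * a\<close> once \<open>a > 3\<close>.\<close>
    then have "8 * a < (a\<^sup>2 - 4) * 3" using \<open>\<not> a < 4\<close> by simp
    also have "\<dots> \<le> (a\<^sup>2 - 4) * (b - a)"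
      using a2 i \<open>i \<le> b - a\<close> by (intro mult_left_mono) auto
    finally show False using assms(3) by simp
  qed
  then have ai: "a = 3" "i = 3" using \<open>i \<le> a\<close> i by auto
  \<comment> \<open>With \<open>b - 3 = 3 * d\<close> this reads
    \<open>15 * d \<le> 24\<close>.\<close>
  then have "5 * (b - 3) \<le> 24" using assms(3) by simp
  with d ai \<open>0 < d\<close> have "d = 1" by simp
  with d ai show ?thesis by simp
qed

text \<open>Removes the candidate \<open>(i, i)\<close> for \<open>i = 3\<close>, whose
  \<open>discr\<close> is -63.\<close>

lemma three_three_not_solution: "(3, 3) \<notin> solutions i"
proof
  assume "(3, 3) \<in> solutions i"
  then obtain k :: int where "- 63 = k\<^sup>2" by (auto simp: solutions_def discr_def)
  moreover have "0 \<le> k\<^sup>2" by simp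
  ultimately show False by linarith
qed

lemma three_six_mem_solutions: "(3, 6) \<in> solutions 3"
proof -
  have "discr (3, 6) = 0\<^sup>2" by (simp add: discr_def)
  then show ?thesis by (auto simp: solutions_def)
qed

lemma four_four_mem_solutions: "(4, 4) \<in> solutions 4"
proof -
  have "discr (4, 4) = 0\<^sup>2" by (simp add: discr_def)
  then show ?thesis by (auto simp: solutions_def)
qed

lemma five_five_mem_solutions: "(5, 5) \<in> solutions 5"
proof -
  have "discr (5, 5) = 15\<^sup>2" by (simp add: discr_def)
  then have "\<exists>k. discr (5, 5) = k\<^sup>2" by blast
  then show ?thesis by (simp add: solutions_def)
qed

lemma descent_3:
  assumes "(a, b) \<in> solutions 3" "(a, b) \<noteq> (3, 6)"
  shows "8 * a < (a\<^sup>2 - 4) * (b - a)"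
proof (rule ccontr)
  assume "\<not> 8 * a < (a\<^sup>2 - 4) * (b - a)"
  from not_separated_cases[OF assms(1) _ this] assms three_three_not_solution[of 3]
  show False by auto
qed

lemma descent_4:
  assumes "(a, b) \<in> solutions 4" "(a, b) \<noteq> (4, 4)"
  shows "8 * a < (a\<^sup>2 - 4) * (b - a)"
proof (rule ccontr)
  assume "\<not> 8 * a < (a\<^sup>2 - 4) * (b - a)"
  from not_separated_cases[OF assms(1) _ this] assms show False by auto
qed

lemma descent_5:
  assumes "(a, b) \<in> solutions 5" "(a, b) \<noteq> (5, 5)"
  shows "8 * a < (a\<^sup>2 - 4) * (b - a)"
proof (rule ccontr)
  assume "\<not> 8 * a < (a\<^sup>2 - 4) * (b - a)"
  from not_separated_cases[OF assms(1) _ this] assms show False by auto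
qed

text \<open>Here \<open>s = 0\<close>, so each quadratic has a double root and the four images
  collapse to two.\<close>

lemma degree_3_6: "vertex_degree (solution_graph 3) (3, 6) = 2"
proof -
  have "vieta_poly 3 6 w = (w - 15) * (w - 15)" "vieta_poly 6 3 w = (w - 39) * (w - 39)" for w
    by (simp_all add: vieta_poly_def power2_eq_square algebra_simps)
  then have "{q. ((3, 6), q) \<in> parcs (solution_graph 3)} = {(3, 15), (6, 39)}"
    using solution_edge_iff[OF three_six_mem_solutions] by (auto simp: int_sort_def)
  then show ?thesis by (simp add: vertex_degree_eq_card)
qed

text \<open>Here \<open>s = 0\<close> and the entries are equal, so all four images agree.\<close>

lemma degree_4_4: "vertex_degree (solution_graph 4) (4, 4) = 1"
proof -
  have "vieta_poly 4 4 w = (w - 20) * (w - 20)" for w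
    by (simp add: vieta_poly_def power2_eq_square algebra_simps)
  then have "{q. ((4, 4), q) \<in> parcs (solution_graph 4)} = {(4, 20)}"
    using solution_edge_iff[OF four_four_mem_solutions] by (auto simp: int_sort_def)
  then show ?thesis by (simp add: vertex_degree_eq_card)
qed

text \<open>Equal entries make the \<open>\<phi>\<close> and \<open>\<psi>\<close> images agree,
  while \<open>s = 15\<close> keeps the two roots distinct.\<close>

lemma degree_5_5: "vertex_degree (solution_graph 5) (5, 5) = 2"
proof -
  have "vieta_poly 5 5 w = (w - 10) * (w - 85)" for w
    by (simp add: vieta_poly_def power2_eq_square algebra_simps)
  then have "{q. ((5, 5), q) \<in> parcs (solution_graph 5)} = {(5, 10), (5, 85)}"
    using solution_edge_iff[OF five_five_mem_solutions] by (auto simp: int_sort_def)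
  then show ?thesis by (simp add: vertex_degree_eq_card)
qed

theorem mainTheorem4:
  shows "(\<forall>i \<in> {3, 4, 5}.
            undirected_tree (solution_graph i) \<and>
            infinite (pverts (solution_graph i)) \<and>
            (\<forall>v \<in> pverts (solution_graph i).
               \<not> is_fundamental i v \<longrightarrow> vertex_degree (solution_graph i) v = 4)) \<and>
         (\<forall>v. is_fundamental 3 v \<longleftrightarrow> v = (3, 6)) \<and>
         (\<forall>v. is_fundamental 4 v \<longleftrightarrow> v = (4, 4)) \<and>
         (\<forall>v. is_fundamental 5 v \<longleftrightarrow> v = (5, 5)) \<and>
         vertex_degree (solution_graph 3) (3, 6) = 2 \<and>
         vertex_degree (solution_graph 5) (5, 5) = 2 \<and>
         vertex_degree (solution_graph 4) (4, 4) = 1"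
  using solution_graph_structure[OF three_six_mem_solutions descent_3]
    solution_graph_structure[OF four_four_mem_solutions descent_4]
    solution_graph_structure[OF five_five_mem_solutions descent_5]
    is_fundamental_iff[OF three_six_mem_solutions descent_3]
    is_fundamental_iff[OF four_four_mem_solutions descent_4]
    is_fundamental_iff[OF five_five_mem_solutions descent_5]
    degree_3_6 degree_5_5 degree_4_4
  by simp

end
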